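(* Let $T$ be an infinite Young tableau. There exists an injection $$\iota:\{\text{peripheral trees in }\Phi(T)\}\to\{\text{all trees in }\Phi(J(T))\}$$ with the following property: for each peripheral tree $\tau$ in $\Phi(T)$, $\tau$ is a subtree of its image $\iota(\tau)$ under the natural inclusion of graphs. Moreover, $\iota$ is uniquely characterized by this property.
   Context: An infinite Young tableau (IYT) is an array $T=(T_{x,y})_{x,y\ge 0}$ of positive integers which is increasing along rows (in $x$ for fixed $y$) and along columns (in $y$ for fixed $x$) and contains each positive integer exactly once. Pairs $(x,y)\in\mathbb{N}_0^2$ are called boxes, where $\mathbb N_0=\{0,1,2,\ldots\}$. The jeu de taquin forest $\Phi(T)$ is the directed graph with vertex set $\mathbb{N}_0^2$ in which each box $(x,y)$ has exactly one outgoing edge, pointing to $(x+1,y)$ if $T_{x+1,y}<T_{x,y+1}$ and to $(x,y+1)$ if $T_{x+1,y}>T_{x,y+1}$. The underlying undirected graph is acyclic; its connected components (with their directed edges) are called the trees of $\Phi(T)$. The tree at the origin is the tree containing the box $(0,0)$; all other trees are called peripheral. The jeu de taquin path of $T$ is the sequence of boxes $(x_0,y_0)=(0,0),(x_1,y_1),\ldots$ obtained by following the outgoing edges of $\Phi(T)$ from the origin. The jeu de taquin map $J$ sends $T$ to the IYT $J(T)$ with $J(T)_{x_{n-1},y_{n-1}}=T_{x_n,y_n}-1$ for $n\ge1$ and $J(T)_{x,y}=T_{x,y}-1$ for boxes $(x,y)$ not on the path. "$\tau$ is a subtree of $\iota(\tau)$ under the natural inclusion" means that every box and every directed edge of $\tau$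 (viewed in $\mathbb N_0^2$) is a box, respectively directed edge, of $\iota(\tau)$. *)

theory Defs
  imports "Graph_Theory.Digraph_Component" "HOL-Library.FuncSet"
begin

type_synonym box = "nat \<times> nat"

definition infinite_young_tableau :: "(box \<Rightarrow> nat) \<Rightarrow> bool" where
  "infinite_young_tableau T \<longleftrightarrow>
     (\<forall>y. strict_mono (\<lambda>x. T (x, y))) \<and>
     (\<forall>x. strict_mono (\<lambda>y. T (x, y))) \<and>
     bij_betw T UNIV {1..}"

text \<open>The entries of a tableau are distinct, so the \<open>else\<close> branch is the
  case \<open>T (x + 1, y) > T (x, y + 1)\<close>.\<close>

fun jdt_next :: "(box \<Rightarrow> nat) \<Rightarrow> box \<Rightarrow> box" where
  "jdt_next T (x, y) = (if T (x + 1, y) < T (x, y + 1) then (x + 1, y) else (x, y + 1))"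

definition jdt_forest :: "(box \<Rightarrow> nat) \<Rightarrow> box pair_pre_digraph" where
  "jdt_forest T = \<lparr> pverts = UNIV, parcs = {(b, jdt_next T b) | b. True} \<rparr>"

text \<open>The trees are the connected components of the underlying undirected graph,
  with their directed edges: \<^const>\<open>connected\<close> is connectedness of the symmetrized
  digraph (and includes nonemptiness), in contrast to \<^const>\<open>strongly_connected\<close>.\<close>

definition jdt_trees :: "(box \<Rightarrow> nat) \<Rightarrow> (box, box \<times> box) pre_digraph set" where
  "jdt_trees T = {\<tau>. pre_digraph.max_subgraph (with_proj (jdt_forest T)) connected \<tau>}"

definition peripheral_trees :: "(box \<Rightarrow> nat) \<Rightarrow> (box, box \<times> box) pre_digraph set" where
  "peripheral_trees T = {\<tau> \<in> jdt_trees T. (0, 0) \<notin> verts \<tau>}"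

primrec jdt_path :: "(box \<Rightarrow> nat) \<Rightarrow> nat \<Rightarrow> box" where
  "jdt_path T 0 = (0, 0)"
| "jdt_path T (Suc n) = jdt_next T (jdt_path T n)"

definition jdt_map :: "(box \<Rightarrow> nat) \<Rightarrow> (box \<Rightarrow> nat)" where
  "jdt_map T b = (if b \<in> range (jdt_path T) then T (jdt_next T b) - 1 else T b - 1)"

lemma jdt_map_path: "jdt_map T (jdt_path T n) = T (jdt_path T (Suc n)) - 1"
  by (simp add: jdt_map_def)

lemma jdt_map_off_path: "b \<notin> range (jdt_path T) \<Longrightarrow> jdt_map T b = T b - 1"
  by (simp add: jdt_map_def)

end

theory Submission
  imports Defs
begin

text \<open>Following the outgoing edges, a box \<open>b\<close> traces its \<^emph>\<open>orbit\<close> under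
  \<^const>\<open>jdt_next\<close>.  Two boxes lie in the same tree exactly when their orbits meet; this is true of
  the graph of any self-map (\<open>weak_components_functional_digraph\<close>).

  Let \<open>b\<close> be a box of a peripheral tree.  Its orbit never meets the jeu de taquin path, so in
  particular the successor of \<open>b\<close> is off the path, and passing to \<open>jdt_map T\<close> lowers the entry there
  by exactly one.  The entry in the competing box above or to the right of \<open>b\<close> is larger and drops
  by at most one: off the path by exactly one, and on the path it is replaced by a larger entry
  before it is lowered.  The smaller of the two entries therefore stays the smaller, and \<open>b\<close> has the
  same outgoing edge in both forests (\<open>jdt_next_jdt_map\<close>).

  Since the orbit of \<open>b\<close> stays in its peripheral tree, the whole orbit is the same in both forests.
  Two consequences give the theorem.  Boxes of one peripheral tree still have meeting orbits in the
  new forest, so the tree is contained in a tree of the new forest, which is unique because distinct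
  trees are disjoint.  And if boxes of two peripheral trees have meeting orbits in the new forest,
  the orbits met already in the old one, so distinct peripheral trees never merge.\<close>

section \<open>Orbits that meet\<close>

definition orbits_meet :: "('a \<Rightarrow> 'a) \<Rightarrow> 'a \<Rightarrow> 'a \<Rightarrow> bool" where
  "orbits_meet f a b \<longleftrightarrow> (\<exists>m n. (f ^^ m) a = (f ^^ n) b)"

lemma orbits_meet_refl [simp]: "orbits_meet f a a"
  unfolding orbits_meet_def by blast

lemma orbits_meet_sym: "orbits_meet f a b \<Longrightarrow> orbits_meet f b a"
  unfolding orbits_meet_def by metis

lemma orbits_meet_trans:
  assumes "orbits_meet f a b" "orbits_meet f b c"
  shows "orbits_meet f a c"
proof -
  obtain m n p q where mn: "(f ^^ m) a = (f ^^ n) b" and pq: "(f ^^ p) b = (f ^^ q) c"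
    using assms unfolding orbits_meet_def by blast
  have "(f ^^ (p + m)) a = (f ^^ (p + n)) b"
    by (simp add: funpow_add mn)
  also have "\<dots> = (f ^^ (n + p)) b"
    by (simp add: add.commute)
  also have "\<dots> = (f ^^ (n + q)) c"
    by (simp add: funpow_add pq)
  finally show ?thesis
    unfolding orbits_meet_def by blast
qed

lemma orbits_meet_funpow: "orbits_meet f a ((f ^^ n) a)"
  unfolding orbits_meet_def by (metis funpow_0)

lemma orbits_meet_step: "orbits_meet f a (f a)"
  using orbits_meet_funpow[of f a 1] by simp

lemma orbits_meet_step_iff: "orbits_meet f a (f b) \<longleftrightarrow> orbits_meet f a b"
  using orbits_meet_trans orbits_meet_sym orbits_meet_step by metis

lemma orbits_meet_eq:
  "orbits_meet f a b \<Longrightarrow> orbits_meet f a = orbits_meet f b"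
  by (intro ext iffI) (blast intro: orbits_meet_trans orbits_meet_sym)+

section \<open>Connected components of the graph of a self-map\<close>

definition functional_digraph :: "('a \<Rightarrow> 'a) \<Rightarrow> 'a pair_pre_digraph" where
  "functional_digraph f = \<lparr> pverts = UNIV, parcs = {(b, f b) | b. True} \<rparr>"

definition orbit_component :: "('a \<Rightarrow> 'a) \<Rightarrow> 'a \<Rightarrow> 'a pair_pre_digraph" where
  "orbit_component f a =
     \<lparr> pverts = {b. orbits_meet f a b}, parcs = {(b, f b) | b. orbits_meet f a b} \<rparr>"

lemma orbit_component_simps [simp]:
  "pverts (orbit_component f a) = {b. orbits_meet f a b}"
  "parcs (orbit_component f a) = {(b, f b) | b. orbits_meet f a b}"
  by (simp_all add: orbit_component_def)

lemma wf_orbit_component: "wf_digraph (with_proj (orbit_component f a))"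
  by unfold_locales (auto simp: orbits_meet_step_iff)

lemma orbit_component_eq:
  "orbits_meet f a b \<Longrightarrow> orbit_component f a = orbit_component f b"
  by (drule orbits_meet_eq) (simp add: orbit_component_def)

lemma subgraph_orbit_component:
  "subgraph (with_proj (orbit_component f a)) (with_proj (functional_digraph f))"
proof -
  have "wf_digraph (with_proj (functional_digraph f))"
    by unfold_locales (auto simp: functional_digraph_def)
  then show ?thesis
    using wf_orbit_component[of f a]
    by (auto simp: subgraph_def functional_digraph_def)
qed

text \<open>Any two vertices of the component walk forward to a common point of their orbits, without
  leaving the component.\<close>

lemma connected_orbit_component: "connected (with_proj (orbit_component f a))"
proof -
  let ?C = "with_proj (orbit_component f a)"
  let ?S = "with_proj (mk_symmetric ?C)"
  interpret C: wf_digraph ?C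
    by (rule wf_orbit_component)
  interpret S: wf_digraph ?S
    using C.wellformed_mk_symmetric by (simp add: wf_digraph_wp_iff)
  have forward: "u \<rightarrow>\<^sup>*\<^bsub>?S\<^esub> (f ^^ n) u" if u: "orbits_meet f a u" for u n
  proof (induction n)
    case 0
    then show ?case
      using u by (simp add: S.reachable_refl)
  next
    case (Suc n)
    have "orbits_meet f a ((f ^^ n) u)"
      using u orbits_meet_funpow orbits_meet_trans by metis
    then have "((f ^^ n) u, f ((f ^^ n) u)) \<in> arcs_ends ?S"
      by (auto simp: parcs_mk_symmetric)
    then show ?case
      using Suc by (simp add: S.reachable_adj_trans)
  qed
  have "u \<rightarrow>\<^sup>*\<^bsub>?S\<^esub> v" if u: "orbits_meet f a u" and v: "orbits_meet f a v" for u v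
  proof -
    have "orbits_meet f u v"
      using u v orbits_meet_sym orbits_meet_trans by metis
    then obtain m n where "(f ^^ m) u = (f ^^ n) v"
      unfolding orbits_meet_def by blast
    moreover have "(f ^^ n) v \<rightarrow>\<^sup>*\<^bsub>?S\<^esub> v"
      using symmetric_mk_symmetric forward[OF v] by (rule symmetric_reachable)
    ultimately show ?thesis
      using forward[OF u, of m] S.reachable_trans by metis
  qed
  moreover have "verts ?C \<noteq> {}"
    by (auto intro: orbits_meet_refl)
  ultimately show ?thesis
    by (auto simp: connected_def strongly_connected_def)
qed

text \<open>An edge joins two vertices whose orbits meet, so a connected subgraph never leaves the
  component of any of its vertices.\<close>

lemma connected_subgraph_le_orbit_component:
  assumes sub: "subgraph H (with_proj (functional_digraph f))"
    and con: "connected H" and a: "a \<in> verts H"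
  shows "subgraph H (with_proj (orbit_component f a))"
proof -
  interpret H: wf_digraph H
    using sub by (simp add: subgraph_def)
  have tail: "tail H = fst" and head: "head H = snd"
    and arcs: "arcs H \<subseteq> {(b, f b) | b. True}"
    using sub by (auto simp: subgraph_def compatible_def functional_digraph_def)
  have "orbits_meet f a b" if "b \<in> verts H" for b
  proof -
    have "a \<rightarrow>\<^sup>*\<^bsub>with_proj (mk_symmetric H)\<^esub> b"
      using con a that by (auto simp: connected_def strongly_connected_def)
    then have "(a, b) \<in> rtrancl_on (verts H) (parcs (mk_symmetric H))"
      by (simp add: reachable_def)
    then show ?thesis
    proof (induction rule: rtrancl_on_induct)
      case base
      then show ?case by simp
    next
      case (step y z)
      then have "z = f y \<or> y = f z"
        using arcs by (auto simp: parcs_mk_symmetric tail head)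
      then show ?case
        using step by (metis orbits_meet_step_iff)
    qed
  qed
  moreover have "fst e \<in> verts H" if "e \<in> arcs H" for e
    using H.tail_in_verts[OF that] by (simp add: tail)
  ultimately show ?thesis
    using arcs wf_orbit_component[of f a] H.wf_digraph_axioms
    by (fastforce simp: subgraph_def compatible_def tail head)
qed

lemma subgraph_antisym: "subgraph G H \<Longrightarrow> subgraph H G \<Longrightarrow> G = H"
  by (auto simp: subgraph_def compatible_def intro: pre_digraph.equality)

text \<open>The orbit component of a vertex is the largest connected subgraph through that vertex, hence
  the only maximal one.\<close>

lemma weak_components_functional_digraph:
  "pre_digraph.max_subgraph (with_proj (functional_digraph f)) connected H
     \<longleftrightarrow> (\<exists>a. H = with_proj (orbit_component f a))"
proof
  let ?G = "with_proj (functional_digraph f)"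
  assume max: "pre_digraph.max_subgraph ?G connected H"
  then have sub: "subgraph H ?G" and con: "connected H"
    by (simp_all add: pre_digraph.max_subgraph_def)
  obtain a where "a \<in> verts H"
    using con by (auto simp: connected_def strongly_connected_def)
  then have "subgraph H (with_proj (orbit_component f a))"
    by (rule connected_subgraph_le_orbit_component[OF sub con])
  then show "\<exists>a. H = with_proj (orbit_component f a)"
    using max subgraph_orbit_component[of f a] connected_orbit_component[of f a]
    unfolding pre_digraph.max_subgraph_def by metis
next
  let ?G = "with_proj (functional_digraph f)"
  assume "\<exists>a. H = with_proj (orbit_component f a)"
  then obtain a where H: "H = with_proj (orbit_component f a)"
    by blast
  have "H' = H" if "subgraph H H'" "subgraph H' ?G" "connected H'" for H'
  proof -
    have "a \<in> verts H'"
      using that(1) by (auto simp: subgraph_def H)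
    then have "subgraph H' H"
      unfolding H by (rule connected_subgraph_le_orbit_component[OF that(2,3)])
    then show ?thesis
      using that(1) by (rule subgraph_antisym)
  qed
  then show "pre_digraph.max_subgraph ?G connected H"
    using subgraph_orbit_component[of f a] connected_orbit_component[of f a]
    unfolding pre_digraph.max_subgraph_def H by metis
qed

section \<open>Two self-maps that agree on a component\<close>

lemma funpow_eq_on_component:
  assumes agree: "\<And>b. orbits_meet f a b \<Longrightarrow> g b = f b"
    and b: "orbits_meet f a b"
  shows "(g ^^ n) b = (f ^^ n) b"
proof (induction n)
  case (Suc n)
  have "orbits_meet f a ((f ^^ n) b)"
    using b orbits_meet_funpow orbits_meet_trans by metis
  then show ?case
    using Suc agree by simp
qed simp

lemma subgraph_orbit_component_cong:
  assumes agree: "\<And>b. orbits_meet f a b \<Longrightarrow> g b = f b"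
  shows "subgraph (with_proj (orbit_component f a)) (with_proj (orbit_component g a))"
proof -
  have "orbits_meet g a b" if b: "orbits_meet f a b" for b
  proof -
    obtain m n where "(f ^^ m) a = (f ^^ n) b"
      using b unfolding orbits_meet_def by blast
    then have "(g ^^ m) a = (g ^^ n) b"
      using funpow_eq_on_component[of f a g, OF agree] b by simp
    then show ?thesis
      unfolding orbits_meet_def by blast
  qed
  then show ?thesis
    using wf_orbit_component agree by (fastforce simp: subgraph_def)
qed

text \<open>Orbits under \<open>f\<close> never leave their components, so where \<open>g\<close> agrees with \<open>f\<close> on both
  components the meeting \<open>g\<close>-orbits are themselves \<open>f\<close>-orbits.  This is why peripheral trees
  cannot merge.\<close>

lemma orbits_meet_reflect:
  assumes "\<And>c. orbits_meet f a c \<Longrightarrow> g c = f c"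
    and "\<And>c. orbits_meet f b c \<Longrightarrow> g c = f c"
    and "orbits_meet g a b"
  shows "orbits_meet f a b"
proof -
  obtain m n where "(g ^^ m) a = (g ^^ n) b"
    using assms(3) unfolding orbits_meet_def by blast
  then have "(f ^^ m) a = (f ^^ n) b"
    using funpow_eq_on_component[of f a g a, OF assms(1)]
      funpow_eq_on_component[of f b g b, OF assms(2)] by simp
  then show ?thesis
    unfolding orbits_meet_def by blast
qed

section \<open>Peripheral trees under the jeu de taquin map\<close>

lemma jdt_trees_eq: "jdt_trees T = {with_proj (orbit_component (jdt_next T) a) | a. True}"
proof -
  have "jdt_forest T = functional_digraph (jdt_next T)"
    by (simp add: jdt_forest_def functional_digraph_def)
  then show ?thesis
    by (simp add: jdt_trees_def weak_components_functional_digraph)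
qed

lemma jdt_treeE:
  assumes "\<tau> \<in> jdt_trees T"
  obtains a where "\<tau> = with_proj (orbit_component (jdt_next T) a)"
  using assms by (auto simp: jdt_trees_eq)

lemma jdt_tree_eq_orbit_component:
  assumes "\<tau> \<in> jdt_trees T" and "a \<in> verts \<tau>"
  shows "\<tau> = with_proj (orbit_component (jdt_next T) a)"
  using assms by (elim jdt_treeE) (auto dest: orbit_component_eq)

lemma jdt_path_eq_funpow: "jdt_path T n = (jdt_next T ^^ n) (0, 0)"
  by (induction n) simp_all

lemma peripheral_off_path:
  assumes "\<not> orbits_meet (jdt_next T) b (0, 0)"
  shows "b \<notin> range (jdt_path T)"
  using assms orbits_meet_funpow orbits_meet_sym by (metis jdt_path_eq_funpow imageE)

lemma jdt_next_larger:
  assumes "infinite_young_tableau T"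
  shows "T b < T (jdt_next T b)"
proof -
  obtain x y where b: "b = (x, y)"
    by fastforce
  have "T (x, y) < T (x + 1, y)" and "T (x, y) < T (x, y + 1)"
    using assms strict_monoD[of "\<lambda>x. T (x, y)" x "x + 1"] strict_monoD[of "\<lambda>y. T (x, y)" y "y + 1"]
    by (simp_all add: infinite_young_tableau_def)
  then show ?thesis
    by (simp add: b)
qed

text \<open>On the path the lowered entry is not \<open>T c\<close> but its successor along the path, which is larger
  than \<open>T c\<close>; so no entry drops by more than one.\<close>

lemma jdt_map_ge:
  assumes "infinite_young_tableau T"
  shows "T c \<le> jdt_map T c + 1"
  using jdt_next_larger[OF assms, of c] by (auto simp: jdt_map_def)

text \<open>In the comparison that decides \<^const>\<open>jdt_next\<close>, the winning entry drops by exactly one and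
  the losing entry by at most one.  When the box above wins, weak inequality is enough, because
  \<^const>\<open>jdt_next\<close> breaks ties in its favour.\<close>

lemma jdt_next_jdt_map:
  assumes T: "infinite_young_tableau T"
    and b: "\<not> orbits_meet (jdt_next T) b (0, 0)"
  shows "jdt_next (jdt_map T) b = jdt_next T b"
proof -
  obtain x y where xy: "b = (x, y)"
    by fastforce
  have "\<not> orbits_meet (jdt_next T) (jdt_next T b) (0, 0)"
    using b orbits_meet_step orbits_meet_trans by metis
  then have winner: "jdt_map T (jdt_next T b) = T (jdt_next T b) - 1"
    by (intro jdt_map_off_path peripheral_off_path)
  \<comment> \<open>If the winning entry were 0, the truncated subtraction would not lower it, and the strict
     inequality could be lost.\<close>
  have pos: "T c > 0" for c
    using T by (auto simp: infinite_young_tableau_def bij_betw_def)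
  show ?thesis
  proof (cases "T (x + 1, y) < T (x, y + 1)")
    case True
    then have "jdt_map T (x + 1, y) < jdt_map T (x, y + 1)"
      using winner pos[of "(x + 1, y)"] jdt_map_ge[OF T, of "(x, y + 1)"] by (simp add: xy)
    then show ?thesis
      using True by (simp add: xy)
  next
    case False
    then have "\<not> jdt_map T (x + 1, y) < jdt_map T (x, y + 1)"
      using winner jdt_map_ge[OF T, of "(x + 1, y)"] by (simp add: xy)
    then show ?thesis
      using False by (simp add: xy)
  qed
qed

theorem proposition3p1:
  fixes T :: "box \<Rightarrow> nat"
  assumes "infinite_young_tableau T"
  shows "\<exists>\<iota> \<in> peripheral_trees T \<rightarrow>\<^sub>E jdt_trees (jdt_map T).
           inj_on \<iota> (peripheral_trees T) \<and>
           (\<forall>\<tau> \<in> peripheral_trees T. subgraph \<tau> (\<iota> \<tau>)) \<and>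
           (\<forall>\<kappa> \<in> peripheral_trees T \<rightarrow>\<^sub>E jdt_trees (jdt_map T).
              (\<forall>\<tau> \<in> peripheral_trees T. subgraph \<tau> (\<kappa> \<tau>)) \<longrightarrow> \<kappa> = \<iota>)"
proof -
  let ?f = "jdt_next T" and ?g = "jdt_next (jdt_map T)"
  let ?P = "peripheral_trees T" and ?Q = "jdt_trees (jdt_map T)"
  have agree: "?g c = ?f c"
    if "with_proj (orbit_component ?f a) \<in> ?P" "orbits_meet ?f a c" for a c
  proof (rule jdt_next_jdt_map[OF assms])
    have "\<not> orbits_meet ?f a (0, 0)"
      using that(1) by (simp add: peripheral_trees_def)
    then show "\<not> orbits_meet ?f c (0, 0)"
      using that(2) orbits_meet_trans by metis
  qed
  have peripheralE: "\<exists>a. \<tau> = with_proj (orbit_component ?f a)" if "\<tau> \<in> ?P" for \<tau>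
    using that unfolding peripheral_trees_def by (blast elim: jdt_treeE)
  have ex: "\<exists>\<sigma> \<in> ?Q. subgraph \<tau> \<sigma>" if "\<tau> \<in> ?P" for \<tau>
  proof -
    obtain a where a: "\<tau> = with_proj (orbit_component ?f a)"
      using peripheralE[OF \<open>\<tau> \<in> ?P\<close>] by blast
    have "subgraph \<tau> (with_proj (orbit_component ?g a))"
      unfolding a using agree[of a] that a by (intro subgraph_orbit_component_cong) simp
    then show ?thesis
      unfolding jdt_trees_eq by blast
  qed
  have uniq: "\<sigma> = \<sigma>'"
    if "\<tau> \<in> ?P" "\<sigma> \<in> ?Q" "\<sigma>' \<in> ?Q" "subgraph \<tau> \<sigma>" "subgraph \<tau> \<sigma>'" for \<tau> \<sigma> \<sigma>'
  proof -
    obtain a where "\<tau> = with_proj (orbit_component ?f a)"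
      using peripheralE[OF \<open>\<tau> \<in> ?P\<close>] by blast
    then have "a \<in> verts \<tau>"
      by simp
    then have "a \<in> verts \<sigma>" "a \<in> verts \<sigma>'"
      using that by (auto simp: subgraph_def)
    then show ?thesis
      using that jdt_tree_eq_orbit_component by metis
  qed
  have inj: "\<tau> = \<tau>'"
    if mem: "\<tau> \<in> ?P" "\<tau>' \<in> ?P" "\<sigma> \<in> ?Q" and sub: "subgraph \<tau> \<sigma>" "subgraph \<tau>' \<sigma>" for \<tau> \<tau>' \<sigma>
  proof -
    obtain a b where a: "\<tau> = with_proj (orbit_component ?f a)"
      and b: "\<tau>' = with_proj (orbit_component ?f b)"
      using peripheralE mem(1,2) by metis
    have "a \<in> verts \<sigma>" and bv: "b \<in> verts \<sigma>"
      using sub by (auto simp: a b subgraph_def)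
    then have "\<sigma> = with_proj (orbit_component ?g a)"
      using mem(3) by (intro jdt_tree_eq_orbit_component)
    then have "orbits_meet ?g a b"
      using bv by simp
    then have "orbits_meet ?f a b"
      using agree[of a] agree[of b] mem(1,2) unfolding a b by (intro orbits_meet_reflect[of ?f a ?g b]) blast+
    then show ?thesis
      unfolding a b by (simp add: orbit_component_eq)
  qed
  define \<iota> where "\<iota> = restrict (\<lambda>\<tau>. SOME \<sigma>. \<sigma> \<in> ?Q \<and> subgraph \<tau> \<sigma>) ?P"
  have \<iota>: "\<iota> \<tau> \<in> ?Q \<and> subgraph \<tau> (\<iota> \<tau>)" if "\<tau> \<in> ?P" for \<tau>
  proof -
    have "\<exists>\<sigma>. \<sigma> \<in> ?Q \<and> subgraph \<tau> \<sigma>"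
      using ex[OF that] by blast
    from someI_ex[OF this] show ?thesis
      by (simp add: \<iota>_def that)
  qed
  show ?thesis
  proof (intro bexI[of _ \<iota>] conjI ballI impI)
    show \<iota>_ext: "\<iota> \<in> ?P \<rightarrow>\<^sub>E ?Q"
      using \<iota> by (auto simp: \<iota>_def)
    show "inj_on \<iota> ?P"
      using \<iota> inj by (metis inj_onI)
    show "subgraph \<tau> (\<iota> \<tau>)" if "\<tau> \<in> ?P" for \<tau>
      using \<iota> that by blast
    show "\<kappa> = \<iota>" if \<kappa>: "\<kappa> \<in> ?P \<rightarrow>\<^sub>E ?Q" and sub: "\<forall>\<tau> \<in> ?P. subgraph \<tau> (\<kappa> \<tau>)" for \<kappa>
    proof (rule PiE_ext[OF \<kappa> \<iota>_ext])
      fix \<tau> assume "\<tau> \<in> ?P"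
      then show "\<kappa> \<tau> = \<iota> \<tau>"
        using uniq[of \<tau> "\<kappa> \<tau>" "\<iota> \<tau>"] \<iota> sub \<kappa> by (auto dest: PiE_mem)
    qed
  qed
qed

end
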